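(* $\mathcal{A}_C$, with the partial order $f\le g\iff F\le G$ pointwise on $\overline{\mathbb{R}}$ (where $F,G\in\mathcal{B}_C$ are the primitives of $f,g$) and the Alexiewicz norm, is a Banach lattice.
   Context: $\mathcal{D}=C_c^\infty(\mathbb{R})$ (real-valued), $\mathcal{D}'$ is the space of distributions, $\langle T',\phi\rangle=-\langle T,\phi'\rangle$; functions are identified with distributions in the usual way. $\overline{\mathbb{R}}=[-\infty,\infty]$. $C^0(\overline{\mathbb{R}})$ is the set of continuous real functions $F$ on $\mathbb{R}$ with real limits at $\pm\infty$, extended by $F(\pm\infty)=\lim_{\pm\infty}F$. $\mathcal{B}_C=\{F\in C^0(\overline{\mathbb{R}}): F(-\infty)=0\}$ and $\mathcal{A}_C=\{f\in\mathcal{D}': f=F' \text{ for some } F\in\mathcal{B}_C\}$; the primitive $F\in\mathcal{B}_C$ of $f\in\mathcal{A}_C$ is unique, and the Alexiewicz norm is $\|f\|=\|F\|_\infty$. Being a Banach lattice means: $\mathcal{A}_C$ is a Banach space; it is a lattice, i.e. any $f,g\in\mathcal{A}_C$ have a supremum $f\vee g$ and an infimum $f\wedge g$ in $\mathcal{A}_C$; and for all $f,g\in\mathcal{A}_C$: (i) $f\le g$ implies $f+h\le g+h$ for all $h\in\mathcal{A}_C$; (ii) $f\le g$ implies $af\le ag$ for all real $a\ge0$; (iii) $|f|\le|g|$ implies $\|f\|\le\|g\|$, where $|f|=f\vee(-f)=|F|'$ (the distributional derivative of the function $|F|$). *)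

theory Defs
  imports "HOL-Analysis.Analysis" "HOL-Algebra.Lattice"
begin

definition smooth :: "(real \<Rightarrow> real) \<Rightarrow> bool" where
  "smooth \<phi> \<longleftrightarrow> (\<forall>n x. (deriv ^^ n) \<phi> field_differentiable at x)"

definition supp :: "(real \<Rightarrow> real) \<Rightarrow> real set" where
  "supp \<phi> = closure {x. \<phi> x \<noteq> 0}"

lemma higher_deriv_lincomb:
  assumes "smooth f" "smooth g"
  shows "(deriv ^^ n) (\<lambda>x. a * f x + b * g x) = (\<lambda>x. a * (deriv ^^ n) f x + b * (deriv ^^ n) g x)"
proof (induction n)
  case (Suc n)
  have "deriv (\<lambda>x. a * (deriv ^^ n) f x + b * (deriv ^^ n) g x) x
      = a * deriv ((deriv ^^ n) f) x + b * deriv ((deriv ^^ n) g) x" for x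
    using assms unfolding smooth_def
    by (intro DERIV_imp_deriv DERIV_add DERIV_cmult) (auto simp: DERIV_deriv_iff_field_differentiable)
  then show ?case by (simp add: Suc fun_eq_iff)
qed simp

lemma smooth_lincomb: "smooth f \<Longrightarrow> smooth g \<Longrightarrow> smooth (\<lambda>x. a * f x + b * g x)"
  unfolding smooth_def[of "\<lambda>x. a * f x + b * g x"] higher_deriv_lincomb
  by (auto simp: smooth_def higher_deriv_lincomb intro!: derivative_intros)

lemma smooth_zero: "smooth (\<lambda>_. 0)"
proof -
  have "(deriv ^^ n) (\<lambda>_::real. 0::real) = (\<lambda>_. 0)" for n
    by (induction n) auto
  then show ?thesis by (simp add: smooth_def)
qed

lemma compact_supp_subset:
  assumes "compact K" "supp f \<subseteq> K"
  shows "compact (supp f)"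
proof -
  have "closed (supp f)" by (simp add: supp_def)
  then have "compact (K \<inter> supp f)" by (rule compact_Int_closed[OF assms(1)])
  moreover have "K \<inter> supp f = supp f" using assms(2) by auto
  ultimately show ?thesis by (simp only:)
qed

lemma compact_supp_lincomb:
  assumes "compact (supp f)" "compact (supp g)"
  shows "compact (supp (\<lambda>x. a * f x + b * g x))"
proof -
  have "supp (\<lambda>x. a * f x + b * g x) \<subseteq> supp f \<union> supp g"
    unfolding supp_def closure_Un[symmetric] by (rule closure_mono) auto
  then show ?thesis by (rule compact_supp_subset[OF compact_Un[OF assms]])
qed

lemma smooth_deriv: "smooth f \<Longrightarrow> smooth (deriv f)"
  unfolding smooth_def
proof (intro allI)
  fix n x
  assume "\<forall>n x. (deriv ^^ n) f field_differentiable at x"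
  then have "(deriv ^^ Suc n) f field_differentiable at x" by blast
  then show "(deriv ^^ n) (deriv f) field_differentiable at x" by (simp add: funpow_swap1)
qed

lemma smooth_isCont: "smooth f \<Longrightarrow> isCont f x"
  unfolding smooth_def by (drule spec[of _ 0]) (simp add: field_differentiable_imp_continuous_at)

lemma supp_deriv_subset: "supp (deriv f) \<subseteq> supp f"
proof -
  have "deriv f x = 0" if "x \<notin> supp f" for x
  proof (rule DERIV_imp_deriv, rule has_field_derivative_transform_within_open[of "\<lambda>_. 0" 0 x "- supp f"])
    show "0 = f y" if "y \<in> - supp f" for y
      using that closure_subset[of "{x. f x \<noteq> 0}"] by (auto simp: supp_def)
  qed (use that in \<open>auto simp: supp_def\<close>)
  then have "{x. deriv f x \<noteq> 0} \<subseteq> supp f" by auto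
  then show ?thesis unfolding supp_def by (simp add: closure_minimal)
qed

typedef test_fun = "{\<phi>. smooth \<phi> \<and> compact (supp \<phi>)}"
  morphisms apply_test Abs_test_fun
  by (rule exI[of _ "\<lambda>_. 0"]) (simp add: smooth_zero supp_def)

setup_lifting type_definition_test_fun

instantiation test_fun :: real_vector
begin

lift_definition zero_test_fun :: test_fun is "\<lambda>_. 0"
  by (simp add: smooth_zero supp_def)

lift_definition plus_test_fun :: "test_fun \<Rightarrow> test_fun \<Rightarrow> test_fun" is "\<lambda>f g x. f x + g x"
  using smooth_lincomb[of _ _ 1 1] compact_supp_lincomb[of _ _ 1 1] by simp

lift_definition uminus_test_fun :: "test_fun \<Rightarrow> test_fun" is "\<lambda>f x. - f x"
  subgoal for f
    using smooth_lincomb[of f f "-1" 0] compact_supp_lincomb[of f f "-1" 0] by simp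
  done

lift_definition minus_test_fun :: "test_fun \<Rightarrow> test_fun \<Rightarrow> test_fun" is "\<lambda>f g x. f x - g x"
  using smooth_lincomb[of _ _ 1 "-1"] compact_supp_lincomb[of _ _ 1 "-1"] by simp

lift_definition scaleR_test_fun :: "real \<Rightarrow> test_fun \<Rightarrow> test_fun" is "\<lambda>a f x. a * f x"
  subgoal for a f
    using smooth_lincomb[of f f a 0] compact_supp_lincomb[of f f a 0] by simp
  done

instance
  by standard (transfer; simp add: fun_eq_iff algebra_simps)+

end

lift_definition test_deriv :: "test_fun \<Rightarrow> test_fun" is deriv
  by (auto intro: smooth_deriv compact_supp_subset[OF _ supp_deriv_subset])

definition test_converges :: "(nat \<Rightarrow> test_fun) \<Rightarrow> test_fun \<Rightarrow> bool" where
  "test_converges \<phi>s \<phi> \<longleftrightarrow>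
     (\<exists>K. compact K \<and> supp (apply_test \<phi>) \<subseteq> K \<and> (\<forall>n. supp (apply_test (\<phi>s n)) \<subseteq> K)) \<and>
     (\<forall>k. uniform_limit UNIV (\<lambda>n. (deriv ^^ k) (apply_test (\<phi>s n)))
                             ((deriv ^^ k) (apply_test \<phi>)) sequentially)"

lemma test_converges_deriv:
  assumes "test_converges \<phi>s \<phi>"
  shows "test_converges (\<lambda>n. test_deriv (\<phi>s n)) (test_deriv \<phi>)"
proof -
  have "(deriv ^^ k) (deriv f) = (deriv ^^ Suc k) f" for k and f :: "real \<Rightarrow> real"
    by (simp add: funpow_swap1)
  moreover obtain K where "compact K" "supp (apply_test \<phi>) \<subseteq> K"
    "\<And>n. supp (apply_test (\<phi>s n)) \<subseteq> K"
    using assms unfolding test_converges_def by blast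
  then have "compact K \<and> supp (deriv (apply_test \<phi>)) \<subseteq> K \<and>
      (\<forall>n. supp (deriv (apply_test (\<phi>s n))) \<subseteq> K)"
    using subset_trans[OF supp_deriv_subset] by blast
  moreover have "uniform_limit UNIV (\<lambda>n. (deriv ^^ Suc k) (apply_test (\<phi>s n)))
      ((deriv ^^ Suc k) (apply_test \<phi>)) sequentially" for k
    using assms unfolding test_converges_def by blast
  ultimately show ?thesis
    unfolding test_converges_def test_deriv.rep_eq by (auto simp del: funpow.simps)
qed

lemma linear_test_deriv: "linear test_deriv"
proof (rule linearI)
  show "test_deriv (f + g) = test_deriv f + test_deriv g" for f g
    by transfer (use higher_deriv_lincomb[of _ _ 1 1 1] in simp)
  show "test_deriv (r *\<^sub>R f) = r *\<^sub>R test_deriv f" for r f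
    using higher_deriv_lincomb[of "apply_test f" "apply_test f" 1 r 0] apply_test[of f]
    by (simp add: test_deriv.rep_eq scaleR_test_fun.rep_eq flip: apply_test_inject)
qed


text \<open>Sequential continuity is equivalent to continuity in the inductive limit topology
  of the space of test functions.\<close>

typedef distribution =
  "{T :: test_fun \<Rightarrow> real. linear T \<and>
      (\<forall>\<phi>s \<phi>. test_converges \<phi>s \<phi> \<longrightarrow> (\<lambda>n. T (\<phi>s n)) \<longlonglongrightarrow> T \<phi>)}"
  morphisms pairing Abs_distribution
  by (rule exI[of _ "\<lambda>_. 0"]) (simp add: module_hom_zero)

setup_lifting type_definition_distribution

instantiation distribution :: real_vector
begin

lift_definition zero_distribution :: distribution is "\<lambda>_. 0"
  by (simp add: module_hom_zero)

lift_definition plus_distribution :: "distribution \<Rightarrow> distribution \<Rightarrow> distribution"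
  is "\<lambda>S T \<phi>. S \<phi> + T \<phi>"
  by (auto intro!: linear_compose_add tendsto_add)

lift_definition uminus_distribution :: "distribution \<Rightarrow> distribution" is "\<lambda>T \<phi>. - T \<phi>"
  by (auto intro!: linear_compose_neg tendsto_minus)

lift_definition minus_distribution :: "distribution \<Rightarrow> distribution \<Rightarrow> distribution"
  is "\<lambda>S T \<phi>. S \<phi> - T \<phi>"
  by (auto intro!: linear_compose_sub tendsto_diff)

lift_definition scaleR_distribution :: "real \<Rightarrow> distribution \<Rightarrow> distribution"
  is "\<lambda>a T \<phi>. a * T \<phi>"
  using linear_compose_scale_right[where 'b = real] by (auto intro!: tendsto_mult_left)

instance
  by standard (transfer; simp add: fun_eq_iff algebra_simps)+

end

lift_definition distr_deriv :: "distribution \<Rightarrow> distribution" is "\<lambda>T \<phi>. - T (test_deriv \<phi>)"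
proof (intro conjI allI impI; elim conjE)
  fix T :: "test_fun \<Rightarrow> real" assume "linear T"
  then show "linear (\<lambda>\<phi>. - T (test_deriv \<phi>))"
    using linear_compose[OF linear_test_deriv, of T] by (simp add: o_def linear_compose_neg)
qed (auto intro!: tendsto_minus simp: test_converges_deriv)

definition locally_integrable :: "(real \<Rightarrow> real) \<Rightarrow> bool" where
  "locally_integrable u \<longleftrightarrow> (\<forall>K. compact K \<longrightarrow> set_integrable lborel K u)"

lemma zero_outside_supp: "x \<notin> supp f \<Longrightarrow> f x = 0"
  using closure_subset[of "{x. f x \<noteq> 0}"] by (auto simp: supp_def)

lemma integrable_mult_test:
  assumes u: "locally_integrable u"
  shows "integrable lborel (\<lambda>x. u x * apply_test \<phi> x)"
proof -
  define f where "f = apply_test \<phi>"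
  have f: "smooth f" "compact (supp f)"
    using apply_test[of \<phi>] by (auto simp: f_def)
  have cont: "continuous_on UNIV f"
    by (simp add: continuous_on_eq_continuous_at f smooth_isCont)
  have "bounded (f ` supp f)"
    using cont f(2) by (meson compact_continuous_image compact_imp_bounded continuous_on_subset subset_UNIV)
  then obtain B where B: "\<And>x. x \<in> supp f \<Longrightarrow> \<bar>f x\<bar> \<le> B"
    by (auto simp: bounded_iff)
  have int: "integrable lborel (\<lambda>x. indicator (supp f) x *\<^sub>R u x)"
    using u f(2) by (auto simp: locally_integrable_def set_integrable_def)
  have [measurable]: "f \<in> borel_measurable borel"
    using cont by (rule borel_measurable_continuous_onI)
  have "integrable lborel (\<lambda>x. (indicator (supp f) x *\<^sub>R u x) * f x)"
  proof (rule Bochner_Integration.integrable_bound)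
    show "integrable lborel (\<lambda>x. B * (indicator (supp f) x *\<^sub>R u x))"
      using int by simp
    show "(\<lambda>x. indicator (supp f) x *\<^sub>R u x * f x) \<in> borel_measurable lborel"
      using borel_measurable_integrable[OF int] by simp
    have "norm (indicator (supp f) x *\<^sub>R u x * f x) \<le> norm (B * (indicator (supp f) x *\<^sub>R u x))" for x
      using B[of x] mult_right_mono[of "\<bar>f x\<bar>" "\<bar>B\<bar>" "\<bar>u x\<bar>"]
      by (auto simp: indicator_def abs_mult mult.commute)
    then show "AE x in lborel. norm (indicator (supp f) x *\<^sub>R u x * f x)
                 \<le> norm (B * (indicator (supp f) x *\<^sub>R u x))" by simp
  qed
  moreover have "(indicator (supp f) x *\<^sub>R u x) * f x = u x * f x" for x
    using zero_outside_supp[of x f] by (auto simp: indicator_def)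
  ultimately show ?thesis by (simp only: f_def)
qed

lemma integral_mult_test_tendsto:
  assumes u: "locally_integrable u" and conv: "test_converges \<phi>s \<phi>"
  shows "(\<lambda>n. LINT x|lborel. u x * apply_test (\<phi>s n) x) \<longlonglongrightarrow> (LINT x|lborel. u x * apply_test \<phi> x)"
proof (rule tendstoI)
  fix e :: real assume "e > 0"
  obtain K where K: "compact K" "supp (apply_test \<phi>) \<subseteq> K" "\<And>n. supp (apply_test (\<phi>s n)) \<subseteq> K"
    using conv by (auto simp: test_converges_def)
  define C where "C = (LINT x|lborel. \<bar>indicator K x *\<^sub>R u x\<bar>)"
  have "C \<ge> 0" by (simp add: C_def)
  have int: "integrable lborel (\<lambda>x. indicator K x *\<^sub>R u x)"
    using u K(1) by (auto simp: locally_integrable_def set_integrable_def)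
  define d where "d = e / (C + 1)"
  have d: "d > 0" using \<open>e > 0\<close> \<open>C \<ge> 0\<close> by (simp add: d_def)
  have "d * C < e" using \<open>e > 0\<close> \<open>C \<ge> 0\<close> by (simp add: d_def field_simps)
  have "uniform_limit UNIV (\<lambda>n. apply_test (\<phi>s n)) (apply_test \<phi>) sequentially"
    using conjunct2[OF conv[unfolded test_converges_def], THEN spec, of 0] by simp
  then have "\<forall>\<^sub>F n in sequentially. \<forall>x\<in>UNIV. dist (apply_test (\<phi>s n) x) (apply_test \<phi> x) < d"
    using d by (rule uniform_limitD)
  then show "\<forall>\<^sub>F n in sequentially. dist (LINT x|lborel. u x * apply_test (\<phi>s n) x)
               (LINT x|lborel. u x * apply_test \<phi> x) < e"
  proof eventually_elim
    case (elim n)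
    let ?g = "\<lambda>x. u x * apply_test (\<phi>s n) x - u x * apply_test \<phi> x"
    have bound: "\<bar>?g x\<bar> \<le> d * \<bar>indicator K x *\<^sub>R u x\<bar>" for x
    proof (cases "x \<in> K")
      case True
      have "\<bar>?g x\<bar> = \<bar>u x\<bar> * \<bar>apply_test (\<phi>s n) x - apply_test \<phi> x\<bar>"
        by (simp add: abs_mult flip: right_diff_distrib)
      also have "\<dots> \<le> \<bar>u x\<bar> * d"
        using elim by (intro mult_left_mono) (auto simp: dist_real_def less_imp_le)
      finally show ?thesis using True by (simp add: mult.commute)
    next
      case False
      then have "apply_test (\<phi>s n) x = 0" "apply_test \<phi> x = 0"
        using K by (auto intro: zero_outside_supp)
      then show ?thesis using d by simp
    qed
    have "\<bar>LINT x|lborel. ?g x\<bar> \<le> (LINT x|lborel. d * \<bar>indicator K x *\<^sub>R u x\<bar>)"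
      using int bound
      by (intro order_trans[OF integral_abs_bound] integral_mono)
         (auto intro!: integrable_abs Bochner_Integration.integrable_diff
                       integrable_mult_test[OF u] integrable_mult_right simp del: scaleR_conv_of_real real_scaleR_def)
    also have "\<dots> = d * C" by (simp add: C_def)
    finally show ?case
      using \<open>d * C < e\<close>
      by (simp add: dist_real_def Bochner_Integration.integral_diff integrable_mult_test[OF u])
  qed
qed

text \<open>The identification of a locally integrable function with the distribution
  \<open>\<phi> \<mapsto> \<integral> u \<phi>\<close>; the value \<open>0\<close> for other functions is a dummy.\<close>

lift_definition distr_of_fun :: "(real \<Rightarrow> real) \<Rightarrow> distribution"
  is "\<lambda>u \<phi>. if locally_integrable u then (LINT x|lborel. u x * apply_test \<phi> x) else 0"
proof (intro conjI allI impI)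
  fix u :: "real \<Rightarrow> real"
  show "linear (\<lambda>\<phi>. if locally_integrable u then LINT x|lborel. u x * apply_test \<phi> x else 0)"
  proof (cases "locally_integrable u")
    case True
    note int = integrable_mult_test[OF True]
    have "linear (\<lambda>\<phi>. LINT x|lborel. u x * apply_test \<phi> x)"
    proof (rule linearI)
      show "(LINT x|lborel. u x * apply_test (f + g) x) =
          (LINT x|lborel. u x * apply_test f x) + (LINT x|lborel. u x * apply_test g x)" for f g
        by (simp add: plus_test_fun.rep_eq distrib_left int)
      show "(LINT x|lborel. u x * apply_test (r *\<^sub>R f) x) =
          r *\<^sub>R (LINT x|lborel. u x * apply_test f x)" for r f
        by (simp add: scaleR_test_fun.rep_eq mult.left_commute)
    qed
    then show ?thesis using True by simp
  qed (simp add: module_hom_zero)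
qed (simp add: integral_mult_test_tendsto)


text \<open>Elements of \<open>C\<^sup>0\<close> of the extended real line are represented as functions on
  \<^typ>\<open>ereal\<close>, that is, already extended to \<open>\<plusminus>\<infinity>\<close> by their limits.\<close>

definition C0_ext :: "(ereal \<Rightarrow> real) set" where
  "C0_ext = {F. continuous_on UNIV (\<lambda>x::real. F (ereal x)) \<and>
               ((\<lambda>x::real. F (ereal x)) \<longlongrightarrow> F \<infinity>) at_top \<and>
               ((\<lambda>x::real. F (ereal x)) \<longlongrightarrow> F (-\<infinity>)) at_bot}"

definition B_C :: "(ereal \<Rightarrow> real) set" where
  "B_C = {F \<in> C0_ext. F (-\<infinity>) = 0}"

definition fun_deriv :: "(ereal \<Rightarrow> real) \<Rightarrow> distribution" where
  "fun_deriv F = distr_deriv (distr_of_fun (\<lambda>x. F (ereal x)))"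

definition A_C :: "distribution set" where
  "A_C = {f. \<exists>F\<in>B_C. f = fun_deriv F}"

text \<open>The definite description is meaningful only on \<^const>\<open>A_C\<close>, where the primitive
  in \<^const>\<open>B_C\<close> exists and is unique; elsewhere the value is arbitrary. The norm and the
  order below inherit this.\<close>

definition primitive :: "distribution \<Rightarrow> ereal \<Rightarrow> real" where
  "primitive f = (THE F. F \<in> B_C \<and> f = fun_deriv F)"

definition alexiewicz_norm :: "distribution \<Rightarrow> real" where
  "alexiewicz_norm f = (SUP x. \<bar>primitive f x\<bar>)"

definition A_C_le :: "distribution \<Rightarrow> distribution \<Rightarrow> bool" where
  "A_C_le f g \<longleftrightarrow> (\<forall>x. primitive f x \<le> primitive g x)"


definition banach_space_on :: "'a::real_vector set \<Rightarrow> ('a \<Rightarrow> real) \<Rightarrow> bool" where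
  "banach_space_on V N \<longleftrightarrow>
     subspace V \<and>
     (\<forall>f\<in>V. 0 \<le> N f) \<and>
     (\<forall>f\<in>V. N f = 0 \<longleftrightarrow> f = 0) \<and>
     (\<forall>f\<in>V. \<forall>a. N (a *\<^sub>R f) = \<bar>a\<bar> * N f) \<and>
     (\<forall>f\<in>V. \<forall>g\<in>V. N (f + g) \<le> N f + N g) \<and>
     (\<forall>X. (\<forall>n. X n \<in> V) \<and> (\<forall>e>0. \<exists>M. \<forall>m\<ge>M. \<forall>n\<ge>M. N (X m - X n) < e)
        \<longrightarrow> (\<exists>f\<in>V. (\<lambda>n::nat. N (X n - f)) \<longlonglongrightarrow> 0))"

definition order_on_set :: "'a set \<Rightarrow> ('a \<Rightarrow> 'a \<Rightarrow> bool) \<Rightarrow> 'a gorder" where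
  "order_on_set V leq = \<lparr>carrier = V, eq = (=), le = leq\<rparr>"

definition lattice_abs :: "'a::real_vector set \<Rightarrow> ('a \<Rightarrow> 'a \<Rightarrow> bool) \<Rightarrow> 'a \<Rightarrow> 'a" where
  "lattice_abs V leq f = f \<squnion>\<^bsub>order_on_set V leq\<^esub> (- f)"

definition banach_lattice_on ::
    "'a::real_vector set \<Rightarrow> ('a \<Rightarrow> 'a \<Rightarrow> bool) \<Rightarrow> ('a \<Rightarrow> real) \<Rightarrow> bool" where
  "banach_lattice_on V leq N \<longleftrightarrow>
     banach_space_on V N \<and>
     lattice (order_on_set V leq) \<and>
     (\<forall>f\<in>V. \<forall>g\<in>V. \<forall>h\<in>V. leq f g \<longrightarrow> leq (f + h) (g + h)) \<and>
     (\<forall>f\<in>V. \<forall>g\<in>V. \<forall>a\<ge>0. leq f g \<longrightarrow> leq (a *\<^sub>R f) (a *\<^sub>R g)) \<and>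
     (\<forall>f\<in>V. \<forall>g\<in>V. leq (lattice_abs V leq f) (lattice_abs V leq g) \<longrightarrow> N f \<le> N g)"

end

(* The only analytic point is the uniqueness of the primitive: if H in B_C satisfies
   int H phi' = 0 for all test functions phi, then H = 0. For a smooth bump eta, the difference
   of eta and its translate by -t is the derivative of a test function, so int H eta equals
   int H(x) eta(x + t) dx, which tends to 0 as t -> infinity because H vanishes at -infinity.
   Hence int H eta = 0 for every bump, and H = 0 by continuity. Consequently A_C is isomorphic,
   as a normed and ordered space, to B_C, i.e. to the continuous functions on the compact space
   of extended reals vanishing at -infinity, with the sup norm and the pointwise order. *)

theory Submission
  imports Defs
begin

subsection \<open>Smooth bump functions\<close>

text \<open>Each derivative is an explicit witness instead of an iterate of \<open>deriv\<close>, so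
  closure under linear combinations, products and affine substitution follows by plain induction on
  the order.\<close>

fun times_differentiable :: "nat \<Rightarrow> (real \<Rightarrow> real) \<Rightarrow> bool" where
  "times_differentiable 0 f \<longleftrightarrow> True"
| "times_differentiable (Suc n) f \<longleftrightarrow>
     (\<exists>f'. (\<forall>x. (f has_real_derivative f' x) (at x)) \<and> times_differentiable n f')"

lemma times_differentiable_SucI:
  "(\<And>x. (f has_real_derivative f' x) (at x)) \<Longrightarrow> times_differentiable n f' \<Longrightarrow>
    times_differentiable (Suc n) f"
  by auto

text \<open>Uniqueness of the derivative identifies the witness with \<open>deriv f\<close>. The
  order is \<open>Suc n\<close> because the n-th iterate must itself still be
  differentiable.\<close>

lemma times_differentiable_deriv_funpow:
  "times_differentiable (Suc n) f \<Longrightarrow> (deriv ^^ n) f field_differentiable at x"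
proof (induction n arbitrary: f)
  case 0
  then show ?case by (auto simp: field_differentiable_def)
next
  case (Suc n)
  then obtain f' where "\<forall>x. (f has_real_derivative f' x) (at x)" "times_differentiable (Suc n) f'"
    by (subst (asm) times_differentiable.simps) blast
  moreover from this have "deriv f = f'"
    by (auto intro: DERIV_imp_deriv)
  ultimately show ?case
    using Suc.IH[of f'] by (simp add: funpow_swap1 del: times_differentiable.simps)
qed

lemma smooth_if_times_differentiable: "(\<And>n. times_differentiable n f) \<Longrightarrow> smooth f"
  unfolding smooth_def using times_differentiable_deriv_funpow by blast

lemma times_differentiable_Suc_imp: "times_differentiable (Suc n) f \<Longrightarrow> times_differentiable n f"
  by (induction n arbitrary: f) (simp, metis times_differentiable.simps(2))

lemma times_differentiable_lincomb:
  "times_differentiable n f \<Longrightarrow> times_differentiable n g \<Longrightarrow>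
    times_differentiable n (\<lambda>x. a * f x + b * g x)"
proof (induction n arbitrary: f g)
  case (Suc n)
  then obtain f' g' where "\<And>x. (f has_real_derivative f' x) (at x)" "times_differentiable n f'"
    "\<And>x. (g has_real_derivative g' x) (at x)" "times_differentiable n g'"
    by auto
  then show ?case
    using Suc.IH by (auto intro!: exI[of _ "\<lambda>x. a * f' x + b * g' x"] derivative_eq_intros)
qed simp

lemma times_differentiable_mult:
  "times_differentiable n f \<Longrightarrow> times_differentiable n g \<Longrightarrow>
    times_differentiable n (\<lambda>x. f x * g x)"
proof (induction n arbitrary: f g)
  case (Suc n)
  then obtain f' g' where f': "\<And>x. (f has_real_derivative f' x) (at x)" "times_differentiable n f'"
    and g': "\<And>x. (g has_real_derivative g' x) (at x)" "times_differentiable n g'"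
    by auto
  \<comment> \<open>The product rule leaves one factor of each summand undifferentiated, so the
    order of \<open>f\<close> and \<open>g\<close> is lowered to \<open>n\<close> before the
    induction hypothesis applies.\<close>
  have "times_differentiable n (\<lambda>x. 1 * (f' x * g x) + 1 * (f x * g' x))"
    using f' g' Suc.prems[THEN times_differentiable_Suc_imp]
    by (intro times_differentiable_lincomb Suc.IH)
  then show ?case
    by (rule times_differentiable_SucI[rotated])
       (use f' g' in \<open>auto intro!: derivative_eq_intros\<close>)
qed simp

lemma times_differentiable_affine:
  "times_differentiable n f \<Longrightarrow> times_differentiable n (\<lambda>x. f (c * x + d))"
proof (induction n arbitrary: f)
  case (Suc n)
  then obtain f' where f': "\<And>x. (f has_real_derivative f' x) (at x)" "times_differentiable n f'"
    by auto
  \<comment> \<open>The summand with factor 0 lets the lemma on linear combinations serve for a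
    scalar multiple.\<close>
  have "times_differentiable n (\<lambda>x. c * f' (c * x + d) + 0 * f' (c * x + d))"
    using Suc.IH[OF f'(2)] by (rule times_differentiable_lincomb) (rule Suc.IH[OF f'(2)])
  moreover have "((\<lambda>x. f (c * x + d)) has_real_derivative
      c * f' (c * x + d) + 0 * f' (c * x + d)) (at x)" for x
  proof -
    have "((\<lambda>x. c * x + d) has_real_derivative c) (at x)"
      by (auto intro!: derivative_eq_intros)
    from DERIV_chain2[OF f'(1) this] show ?thesis by (simp add: mult.commute)
  qed
  ultimately show ?case by (intro times_differentiable_SucI)
qed simp

section \<open>The flat function exp(-1/x)\<close>

text \<open>For positive x this is exp(-1/x) divided by the k-th power of x. The parameter
  \<open>k\<close> makes the family closed under differentiation up to linear combinations;
  \<open>k = 0\<close> is the classical flat function.\<close>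

definition flat_exp :: "nat \<Rightarrow> real \<Rightarrow> real" where
  "flat_exp k x = (if x \<le> 0 then 0 else inverse x ^ k / exp (inverse x))"

text \<open>With u = 1/x the right-hand limit becomes that of \<open>u ^ k / exp u\<close> at
  infinity.\<close>

lemma flat_exp_tendsto_0: "flat_exp k \<midarrow>0\<rightarrow> 0"
proof (rule filterlim_split_at)
  have "((\<lambda>_. 0) \<longlongrightarrow> (0::real)) (at_left 0)" by simp
  then show "(flat_exp k \<longlongrightarrow> 0) (at_left 0)"
    by (rule tendsto_cong[THEN iffD1, rotated])
       (auto simp: flat_exp_def eventually_at_filter)
  have "((\<lambda>x. inverse x ^ k / exp (inverse x)) \<longlongrightarrow> 0) (at_right (0::real))"
    by (rule filterlim_compose[OF tendsto_power_div_exp_0 filterlim_inverse_at_top_right])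
  then show "(flat_exp k \<longlongrightarrow> 0) (at_right 0)"
    by (rule tendsto_cong[THEN iffD1, rotated])
       (auto simp: flat_exp_def eventually_at_filter)
qed

text \<open>The derivative is written so that it matches \<open>times_differentiable_lincomb\<close>.\<close>

lemma has_real_derivative_flat_exp:
  "(flat_exp k has_real_derivative 1 * flat_exp (k + 2) x + (- real k) * flat_exp (k + 1) x) (at x)"
proof -
  consider "x < 0" | "x = 0" | "x > 0" by linarith
  then show ?thesis
  proof cases
    case 1
    show ?thesis
      by (rule has_field_derivative_transform_within_open[of "\<lambda>_. 0" _ _ "{..<0}"])
         (use 1 in \<open>auto simp: flat_exp_def\<close>)
  next
    case 2
    \<comment> \<open>The difference quotient at 0 is the next member of the family, whose limit is
      known.\<close>
    have "(\<lambda>h. (flat_exp k (0 + h) - flat_exp k 0) / h) = flat_exp (Suc k)"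
      by (auto simp: flat_exp_def fun_eq_iff field_simps)
    then have "(flat_exp k has_real_derivative 0) (at 0)"
      unfolding DERIV_def by (simp only: flat_exp_tendsto_0)
    then show ?thesis using 2 by (simp add: flat_exp_def)
  next
    case 3
    \<comment> \<open>The chain rule is applied with u = 1/x. For \<open>k = 0\<close> the truncated
      exponent \<open>k - 1\<close> is harmless, since its coefficient is 0.\<close>
    have "((\<lambda>y. y ^ k * exp (- y)) has_real_derivative
        real k * u ^ (k - 1) * exp (- u) - u ^ k * exp (- u)) (at u)" for u :: real
      by (auto intro!: derivative_eq_intros)
    then have "((\<lambda>x. inverse x ^ k * exp (- inverse x)) has_real_derivative
        (real k * inverse x ^ (k - 1) * exp (- inverse x) - inverse x ^ k * exp (- inverse x))
          * - (inverse x ^ Suc (Suc 0))) (at x)"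
      using 3 by (intro DERIV_chain2[OF _ DERIV_inverse]) auto
    also have "(real k * inverse x ^ (k - 1) * exp (- inverse x) - inverse x ^ k * exp (- inverse x))
          * - (inverse x ^ Suc (Suc 0)) = 1 * flat_exp (k + 2) x + (- real k) * flat_exp (k + 1) x"
      using 3 by (cases k) (simp_all add: flat_exp_def exp_minus divide_inverse algebra_simps)
    finally show ?thesis
      by (rule has_field_derivative_transform_within_open[of _ _ _ "{0<..}"])
         (use 3 in \<open>auto simp: flat_exp_def exp_minus divide_inverse\<close>)
  qed
qed

text \<open>Differentiation raises \<open>k\<close>, so the induction on \<open>n\<close> treats all
  \<open>k\<close> at once.\<close>

lemma times_differentiable_flat_exp: "times_differentiable n (flat_exp k)"
proof (induction n arbitrary: k)
  case (Suc n)
  then have "times_differentiable n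
      (\<lambda>x. 1 * flat_exp (k + 2) x + (- real k) * flat_exp (k + 1) x)"
    by (intro times_differentiable_lincomb)
  then show ?case
    by (rule times_differentiable_SucI[OF has_real_derivative_flat_exp])
qed simp

section \<open>Bumps and their antiderivatives\<close>

definition bump :: "real \<Rightarrow> real \<Rightarrow> real \<Rightarrow> real" where
  "bump a b x = flat_exp 0 (x - a) * flat_exp 0 (b - x)"

lemma bump_nonneg: "0 \<le> bump a b x"
  by (simp add: bump_def flat_exp_def)

lemma bump_pos: "a < x \<Longrightarrow> x < b \<Longrightarrow> 0 < bump a b x"
  by (simp add: bump_def flat_exp_def)

lemma bump_eq_0: "x \<notin> {a<..<b} \<Longrightarrow> bump a b x = 0"
  by (auto simp: bump_def flat_exp_def)

lemma times_differentiable_bump: "times_differentiable n (bump a b)"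
proof -
  have "times_differentiable n (\<lambda>x. flat_exp 0 (1 * x + - a) * flat_exp 0 ((-1) * x + b))"
    by (intro times_differentiable_mult times_differentiable_affine times_differentiable_flat_exp)
  then show ?thesis by (simp add: bump_def[abs_def])
qed

lemma continuous_on_bump: "continuous_on A (bump a b)"
proof -
  obtain f' where "\<And>x. (bump a b has_real_derivative f' x) (at x)"
    using times_differentiable_bump[of 1 a b] by auto
  then show ?thesis
    by (intro DERIV_continuous_on[OF has_field_derivative_at_within])
qed

lemma integrable_mult_bump:
  assumes "continuous_on UNIV H"
  shows "integrable lborel (\<lambda>x. H x * bump a b x)"
proof -
  have "integrable lborel (\<lambda>x. indicator {a..b} x *\<^sub>R (H x * bump a b x))"
    by (intro borel_integrable_compact continuous_intros continuous_on_bump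
        continuous_on_subset[OF assms]) auto
  also have "(\<lambda>x. indicator {a..b} x *\<^sub>R (H x * bump a b x)) = (\<lambda>x. H x * bump a b x)"
  proof
    show "indicator {a..b} x *\<^sub>R (H x * bump a b x) = H x * bump a b x" for x
      by (cases "x \<in> {a<..<b}") (auto simp: bump_eq_0)
  qed
  finally show ?thesis .
qed

text \<open>To the right of \<open>b\<close> the antiderivative is constant but in general not 0, so
  it is no test function itself; the constant cancels in the difference of two translates.\<close>

lemma bump_antiderivative:
  assumes "a \<le> b"
  obtains E where "\<And>x. (E has_real_derivative bump a b x) (at x)"
    "\<And>x. x \<le> a \<Longrightarrow> E x = 0" "\<And>x. x \<ge> b \<Longrightarrow> E x = E b"
proof -
  \<comment> \<open>Starting at \<open>a - 1\<close> puts every x \<ge> a into the interior of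
    \<open>{a - 1..x + 1}\<close>, which gives a two-sided derivative; to the left of
    \<open>a\<close> the function is locally 0.\<close>
  define E where "E x = integral {a - 1..x} (bump a b)" for x
  have E0: "E x = 0" if "x \<le> a" for x
  proof -
    have "E x = integral {a - 1..x} (\<lambda>_. 0)"
      unfolding E_def by (rule integral_cong) (use that in \<open>auto simp: bump_eq_0\<close>)
    then show ?thesis by simp
  qed
  have deriv: "(E has_real_derivative bump a b x) (at x)" for x
  proof (cases "x < a")
    case True
    show ?thesis
      by (rule has_field_derivative_transform_within_open[of "\<lambda>_. 0" _ _ "{..<a}"])
         (use True in \<open>auto simp: E0 bump_eq_0\<close>)
  next
    case False
    then have "(E has_real_derivative bump a b x) (at x within {a - 1..x + 1})"
      unfolding E_def by (intro integral_has_real_derivative continuous_on_bump) auto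
    moreover have "at x within {a - 1..x + 1} = at x"
      using False by (intro at_within_interior) auto
    ultimately show ?thesis by simp
  qed
  have "E x = E b" if "x \<ge> b" for x
  \<comment> \<open>The right end \<open>x + 1\<close> keeps the interval nondegenerate when
    \<open>x = b\<close>.\<close>
  proof (rule DERIV_isconst2[of b "x + 1"])
    show "continuous_on {b..x + 1} E"
      by (rule DERIV_continuous_on[OF has_field_derivative_at_within[OF deriv]])
    show "(E has_real_derivative 0) (at y)" if "b < y" "y < x + 1" for y
      using deriv[of y] that by (simp add: bump_eq_0)
  qed (use that in auto)
  then show thesis using that deriv E0 by blast
qed

text \<open>For an antiderivative \<open>E\<close> of the bump, \<open>E x - E (x + t)\<close>
  vanishes far to the left and, as the constants cancel, far to the right.\<close>

lemma bump_difference_has_test_antiderivative: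
  assumes "a < b"
  obtains \<phi> where "\<And>x. deriv (apply_test \<phi>) x = bump a b x - bump a b (x + t)"
proof -
  obtain E where E: "\<And>x. (E has_real_derivative bump a b x) (at x)"
    "\<And>x. x \<le> a \<Longrightarrow> E x = 0" "\<And>x. x \<ge> b \<Longrightarrow> E x = E b"
    using bump_antiderivative[of a b] assms by auto
  have E_diff: "times_differentiable n E" for n
    using times_differentiable_SucI[OF E(1) times_differentiable_bump, of n]
    by (rule times_differentiable_Suc_imp)
  define f where "f x = E x - E (x + t)" for x
  have "times_differentiable n (\<lambda>x. 1 * E x + (-1) * E (1 * x + t))" for n
    by (intro times_differentiable_lincomb times_differentiable_affine E_diff)
  then have "smooth f"
    by (intro smooth_if_times_differentiable) (simp add: f_def[abs_def])
  \<comment> \<open>The shift \<open>t\<close> may have either sign, hence \<open>min\<close> and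
    \<open>max\<close>.\<close>
  moreover have "supp f \<subseteq> {min a (a - t)..max b (b - t)}"
    unfolding supp_def
  proof (intro closure_minimal subsetI)
    fix x assume "x \<in> {x. f x \<noteq> 0}"
    then have "\<not> (x \<le> a \<and> x + t \<le> a)" "\<not> (b \<le> x \<and> b \<le> x + t)"
      using E(2)[of x] E(2)[of "x + t"] E(3)[of x] E(3)[of "x + t"] by (auto simp: f_def)
    then show "x \<in> {min a (a - t)..max b (b - t)}" by auto
  qed simp
  then have "compact (supp f)"
    by (rule compact_supp_subset[OF compact_Icc])
  ultimately have "apply_test (Abs_test_fun f) = f"
    by (simp add: Abs_test_fun_inverse)
  moreover have "deriv f x = bump a b x - bump a b (x + t)" for x
    unfolding f_def using E(1) by (intro DERIV_imp_deriv DERIV_diff) (simp_all add: DERIV_shift[symmetric])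
  ultimately show thesis using that by metis
qed

subsection \<open>Functions annihilating derivatives of test functions\<close>

lemma integral_shifted_bump:
  "(LINT x|lborel. bump a b (x + t)) = (LINT x|lborel. bump a b x)"
  using lborel_integral_real_affine[of 1 "bump a b" t] by (simp add: add.commute)

lemma integrable_mult_shifted_bump:
  assumes "continuous_on UNIV H"
  shows "integrable lborel (\<lambda>x. H x * bump a b (x + t))"
proof -
  have "bump a b (x + t) = bump (a - t) (b - t) x" for x
    by (simp add: bump_def algebra_simps)
  then show ?thesis by (simp add: integrable_mult_bump[OF assms])
qed

lemma integral_mult_bump_eq_0:
  assumes cont: "continuous_on UNIV H" and lim: "(H \<longlongrightarrow> 0) at_bot" and "a < b"
    and orth: "\<And>\<phi>. (LINT x|lborel. H x * deriv (apply_test \<phi>) x) = 0"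
  shows "(LINT x|lborel. H x * bump a b x) = 0" (is "?I = 0")
proof -
  define c where "c = (LINT x|lborel. bump a b x)"
  have "c \<ge> 0" unfolding c_def by (simp add: bump_nonneg)
  have *: "\<bar>?I\<bar> \<le> e * c" if "e > 0" for e
  proof -
    have "eventually (\<lambda>x. \<bar>H x\<bar> < e) at_bot"
      using tendstoD[OF lim that] by simp
    then obtain N where N: "\<And>x. x \<le> N \<Longrightarrow> \<bar>H x\<bar> < e"
      by (auto simp: eventually_at_bot_linorder)
    \<comment> \<open>With this shift the translated bump vanishes to the right of
      \<open>b - t = N\<close>, so it only sees points where \<open>H\<close> is smaller than
      \<open>e\<close> in absolute value.\<close>
    define t where "t = b - N"
    obtain \<phi> where "\<And>x. deriv (apply_test \<phi>) x = bump a b x - bump a b (x + t)"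
      using bump_difference_has_test_antiderivative[OF \<open>a < b\<close>, of t] by blast
    then have "?I = (LINT x|lborel. H x * bump a b (x + t))"
      using orth[of \<phi>] Bochner_Integration.integral_diff[OF
          integrable_mult_bump[OF cont] integrable_mult_shifted_bump[OF cont], of a b a b t]
      by (simp add: right_diff_distrib)
    also have "\<bar>\<dots>\<bar> \<le> (LINT x|lborel. e * bump a b (x + t))"
    proof (rule order_trans[OF integral_abs_bound], rule integral_mono)
      show "integrable lborel (\<lambda>x. \<bar>H x * bump a b (x + t)\<bar>)"
        by (intro integrable_abs integrable_mult_shifted_bump[OF cont])
      show "integrable lborel (\<lambda>x. e * bump a b (x + t))"
        by (intro integrable_mult_shifted_bump) simp
      show "\<bar>H x * bump a b (x + t)\<bar> \<le> e * bump a b (x + t)" for x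
      proof (cases "x \<le> N")
        case True
        then show ?thesis
          using N[of x] by (auto simp: abs_mult bump_nonneg intro!: mult_right_mono)
      next
        case False
        then show ?thesis by (simp add: bump_eq_0 t_def)
      qed
    qed
    also have "\<dots> = e * c" by (simp add: integral_shifted_bump c_def)
    finally show ?thesis .
  qed
  have "\<bar>?I\<bar> \<le> 0 + e" if "e > 0" for e
  proof -
    \<comment> \<open>Dividing by \<open>c + 1\<close> instead of \<open>c\<close> avoids a separate
      case for \<open>c = 0\<close>.\<close>
    have "\<bar>?I\<bar> \<le> e / (c + 1) * c" using that \<open>c \<ge> 0\<close> by (intro *) simp
    also have "\<dots> \<le> e" using that \<open>c \<ge> 0\<close> by (simp add: field_simps)
    finally show ?thesis by simp
  qed
  then have "\<bar>?I\<bar> \<le> 0" by (rule field_le_epsilon)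
  then show ?thesis by simp
qed

text \<open>If \<open>H\<close> were positive at \<open>z\<close>, it would be positive on an
  interval around \<open>z\<close>. The product of \<open>H\<close> with the bump on that interval
  is nonnegative with integral 0, hence 0 almost everywhere, although it is positive on the
  interval.\<close>

lemma nonpos_if_orthogonal_to_test_derivatives:
  assumes cont: "continuous_on UNIV H" and lim: "(H \<longlongrightarrow> 0) at_bot"
    and orth: "\<And>\<phi>. (LINT x|lborel. H x * deriv (apply_test \<phi>) x) = 0"
  shows "H z \<le> 0"
proof (rule ccontr)
  assume "\<not> H z \<le> 0"
  then have "z \<in> {x. 0 < H x}" by simp
  moreover have "open {x. 0 < H x}"
    using cont by (intro open_Collect_less) auto
  ultimately obtain e where e: "e > 0" "ball z e \<subseteq> {x. 0 < H x}"
    by (metis open_contains_ball)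
  define a where "a = z - e"
  define b where "b = z + e"
  have ab: "a < b" "{a<..<b} \<subseteq> {x. 0 < H x}"
    using e by (auto simp: a_def b_def ball_eq_greaterThanLessThan)
  have nonneg: "0 \<le> H x * bump a b x" for x
    using ab bump_eq_0[of x a b] bump_nonneg[of a b x] by (cases "x \<in> {a<..<b}") auto
  have "AE x in lborel. H x * bump a b x = 0"
    using integral_nonneg_eq_0_iff_AE[OF integrable_mult_bump[OF cont]] nonneg
      integral_mult_bump_eq_0[OF cont lim ab(1) orth] by simp
  moreover have "H x * bump a b x \<noteq> 0" if "x \<in> {a<..<b}" for x
    using that ab bump_pos[of a x b] by auto
  ultimately have "AE x in lborel. x \<notin> {a<..<b}"
    by (auto elim!: eventually_mono)
  then have "emeasure lborel {a<..<b} = 0"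
    by (subst (asm) AE_iff_measurable[of "{a<..<b}"]) auto
  then show False using ab by simp
qed

text \<open>The hypotheses are invariant under negation, so the one-sided bound applies to
  \<open>H\<close> and to \<open>- H\<close>.\<close>

lemma eq_0_if_orthogonal_to_test_derivatives:
  assumes cont: "continuous_on UNIV H" and lim: "(H \<longlongrightarrow> 0) at_bot"
    and orth: "\<And>\<phi>. (LINT x|lborel. H x * deriv (apply_test \<phi>) x) = 0"
  shows "H z = 0"
proof (rule antisym)
  show "H z \<le> 0" using assms by (rule nonpos_if_orthogonal_to_test_derivatives)
  have "(\<lambda>x. - H x) z \<le> 0"
    by (rule nonpos_if_orthogonal_to_test_derivatives)
       (use tendsto_minus[OF lim] in \<open>simp_all add: orth continuous_on_minus[OF cont]\<close>)
  then show "0 \<le> H z" by simp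
qed

subsection \<open>The isomorphism between primitives and distributions\<close>

lemma at_MInfty_ereal: "at (-\<infinity>::ereal) = filtermap ereal at_bot"
proof -
  have "{..<-\<infinity>::ereal} = {}" by auto
  then have "at_left (-\<infinity>::ereal) = bot" by simp
  then show ?thesis
    by (simp add: at_eq_sup_left_right at_right_MInf)
qed

text \<open>Punctured neighbourhoods in \<open>ereal\<close> are images of the real filters at a
  point, at infinity and at -infinity, which matches the three conditions of \<open>C0_ext\<close>.
  This form makes the compactness of \<open>ereal\<close> available.\<close>

lemma C0_ext_iff: "F \<in> C0_ext \<longleftrightarrow> continuous_on UNIV F"
proof
  assume F: "F \<in> C0_ext"
  have "(F \<longlongrightarrow> F x) (at x)" for x
  proof (cases x)
    case (real r)
    have "isCont (\<lambda>x. F (ereal x)) r"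
      using F by (auto simp: C0_ext_def continuous_on_eq_continuous_at)
    then show ?thesis
      by (simp add: real at_ereal filterlim_filtermap isCont_def)
  qed (use F in \<open>auto simp: C0_ext_def at_infty_ereal_eq_at_top at_MInfty_ereal filterlim_filtermap\<close>)
  then show "continuous_on UNIV F"
    by (simp add: continuous_on_eq_continuous_at isCont_def)
next
  assume F: "continuous_on UNIV F"
  then have lim: "(F \<longlongrightarrow> F x) (at x)" for x
    by (simp add: continuous_on_eq_continuous_at isCont_def)
  have "continuous_on UNIV (\<lambda>x. F (ereal x))"
    by (rule continuous_on_compose2[OF F]) (auto intro!: continuous_intros)
  with lim[of \<infinity>] lim[of "-\<infinity>"] show "F \<in> C0_ext"
    by (simp add: C0_ext_def at_infty_ereal_eq_at_top at_MInfty_ereal filterlim_filtermap)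
qed

lemma B_C_iff: "F \<in> B_C \<longleftrightarrow> continuous_on UNIV F \<and> F (-\<infinity>) = 0"
  by (simp add: B_C_def C0_ext_iff)

lemma B_C_lincomb: "F \<in> B_C \<Longrightarrow> G \<in> B_C \<Longrightarrow> (\<lambda>x. a * F x + b * G x) \<in> B_C"
  by (auto simp: B_C_iff intro!: continuous_intros)

text \<open>The image of the compact space \<open>ereal\<close> is compact, hence bounded.\<close>

lemma B_C_bcontfun: "F \<in> B_C \<Longrightarrow> F \<in> bcontfun"
  using compact_continuous_image[OF _ compact_UNIV, of F]
  by (auto simp: B_C_iff bcontfun_def compact_imp_bounded)

lemma locally_integrable_continuous: "continuous_on UNIV u \<Longrightarrow> locally_integrable u"
  unfolding locally_integrable_def set_integrable_def
  by (intro allI impI borel_integrable_compact) (assumption, erule continuous_on_subset, simp)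

lemma locally_integrable_B_C: "F \<in> B_C \<Longrightarrow> locally_integrable (\<lambda>x. F (ereal x))"
  by (rule locally_integrable_continuous) (simp add: B_C_def C0_ext_def)

section \<open>Linearity and injectivity of the passage to distributions\<close>

lemma pairing_fun_deriv:
  assumes "F \<in> B_C"
  shows "pairing (fun_deriv F) \<phi> = - (LINT x|lborel. F (ereal x) * deriv (apply_test \<phi>) x)"
  using locally_integrable_B_C[OF assms]
  by (simp add: fun_deriv_def distr_deriv.rep_eq distr_of_fun.rep_eq test_deriv.rep_eq)

lemma fun_deriv_lincomb:
  assumes "F \<in> B_C" "G \<in> B_C"
  shows "fun_deriv (\<lambda>x. a * F x + b * G x) = a *\<^sub>R fun_deriv F + b *\<^sub>R fun_deriv G"
proof -
  have "integrable lborel (\<lambda>x. H (ereal x) * deriv (apply_test \<phi>) x)" if "H \<in> B_C" for H \<phi>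
    using integrable_mult_test[OF locally_integrable_B_C[OF that], of "test_deriv \<phi>"]
    by (simp add: test_deriv.rep_eq)
  note int = this[OF assms(1)] this[OF assms(2)]
  have "pairing (fun_deriv (\<lambda>x. a * F x + b * G x)) \<phi>
      = pairing (a *\<^sub>R fun_deriv F + b *\<^sub>R fun_deriv G) \<phi>" for \<phi>
    using int
    by (simp add: pairing_fun_deriv B_C_lincomb assms plus_distribution.rep_eq
        scaleR_distribution.rep_eq distrib_right mult.assoc)
  then show ?thesis by (simp add: fun_eq_iff flip: pairing_inject)
qed

lemma fun_deriv_eq_0_imp:
  assumes "F \<in> B_C" "fun_deriv F = 0"
  shows "F x = 0"
proof -
  have "(LINT x|lborel. F (ereal x) * deriv (apply_test \<phi>) x) = 0" for \<phi>
    using pairing_fun_deriv[OF assms(1), of \<phi>] by (simp add: assms(2) zero_distribution.rep_eq)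
  then have F0: "F (ereal r) = 0" for r
    using assms(1) by (intro eq_0_if_orthogonal_to_test_derivatives[of "\<lambda>r. F (ereal r)"])
      (auto simp: B_C_def C0_ext_def)
  \<comment> \<open>The infinite points are settled separately: at infinity the value is the limit
    of the real values, at -infinity it is 0 by definition of \<open>B_C\<close>.\<close>
  then have "((\<lambda>r::real. 0) \<longlongrightarrow> F \<infinity>) at_top"
    using assms(1) by (simp add: B_C_def C0_ext_def)
  then have "F \<infinity> = 0"
    by (simp add: tendsto_const_iff)
  then show ?thesis
    using F0 assms(1) by (cases x) (auto simp: B_C_def)
qed

lemma inj_on_fun_deriv: "inj_on fun_deriv B_C"
proof (rule inj_onI, rule ext)
  fix F G x
  assume *: "F \<in> B_C" "G \<in> B_C" "fun_deriv F = fun_deriv G"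
  then have "1 * F x + (-1) * G x = 0"
    by (intro fun_deriv_eq_0_imp[OF B_C_lincomb]) (simp_all only: fun_deriv_lincomb, simp)
  then show "F x = G x" by simp
qed

text \<open>Injectivity turns the definite description into a genuine inverse of
  \<open>fun_deriv\<close> on \<open>B_C\<close>.\<close>

lemma primitive_fun_deriv [simp]: "F \<in> B_C \<Longrightarrow> primitive (fun_deriv F) = F"
  unfolding primitive_def by (rule the_equality) (use inj_onD[OF inj_on_fun_deriv] in metis)+

lemma fun_deriv_in_A_C [intro]: "F \<in> B_C \<Longrightarrow> fun_deriv F \<in> A_C"
  by (auto simp: A_C_def)

lemma primitive_in_B_C: "f \<in> A_C \<Longrightarrow> primitive f \<in> B_C"
  by (auto simp: A_C_def)

lemma fun_deriv_primitive [simp]: "f \<in> A_C \<Longrightarrow> fun_deriv (primitive f) = f"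
  by (auto simp: A_C_def)

section \<open>Transfer of the vector operations and the norm\<close>

text \<open>All vector operations below are obtained from this by choosing the coefficients.\<close>

lemma A_C_lincomb:
  assumes "f \<in> A_C" "g \<in> A_C"
  shows "a *\<^sub>R f + b *\<^sub>R g \<in> A_C"
    and "primitive (a *\<^sub>R f + b *\<^sub>R g) = (\<lambda>x. a * primitive f x + b * primitive g x)"
proof -
  let ?F = "\<lambda>x. a * primitive f x + b * primitive g x"
  have F: "?F \<in> B_C" "a *\<^sub>R f + b *\<^sub>R g = fun_deriv ?F"
    using assms by (simp_all add: B_C_lincomb fun_deriv_lincomb primitive_in_B_C)
  show "a *\<^sub>R f + b *\<^sub>R g \<in> A_C" "primitive (a *\<^sub>R f + b *\<^sub>R g) = ?F"
    using F(1) by (auto simp: F(2))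
qed

lemma subspace_A_C: "subspace A_C"
proof (rule subspaceI)
  have 0: "(\<lambda>_. 0) \<in> B_C" by (simp add: B_C_iff)
  show "0 \<in> A_C"
    using A_C_lincomb(1)[of _ _ 0 0] fun_deriv_in_A_C[OF 0] by simp
  show "f + g \<in> A_C" if "f \<in> A_C" "g \<in> A_C" for f g
    using A_C_lincomb(1)[OF that, of 1 1] by simp
  show "a *\<^sub>R f \<in> A_C" if "f \<in> A_C" for a f
    using A_C_lincomb(1)[OF that that, of a 0] by simp
qed

lemma primitive_add: "f \<in> A_C \<Longrightarrow> g \<in> A_C \<Longrightarrow> primitive (f + g) = (\<lambda>x. primitive f x + primitive g x)"
  using A_C_lincomb(2)[of f g 1 1] by simp

lemma primitive_diff: "f \<in> A_C \<Longrightarrow> g \<in> A_C \<Longrightarrow> primitive (f - g) = (\<lambda>x. primitive f x - primitive g x)"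
  using A_C_lincomb(2)[of f g 1 "-1"] by simp

lemma primitive_scaleR: "f \<in> A_C \<Longrightarrow> primitive (a *\<^sub>R f) = (\<lambda>x. a * primitive f x)"
  using A_C_lincomb(2)[of f f a 0] by simp

lemma primitive_uminus: "f \<in> A_C \<Longrightarrow> primitive (- f) = (\<lambda>x. - primitive f x)"
  using primitive_scaleR[of f "-1"] by simp

text \<open>On \<open>A_C\<close> this is a linear isometry into the bounded continuous functions
  with the sup norm, from which the norm laws are inherited.\<close>

definition primitive_bcontfun :: "distribution \<Rightarrow> ereal \<Rightarrow>\<^sub>C real" where
  "primitive_bcontfun f = Bcontfun (primitive f)"

lemma apply_primitive_bcontfun [simp]:
  "f \<in> A_C \<Longrightarrow> apply_bcontfun (primitive_bcontfun f) = primitive f"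
  by (simp add: primitive_bcontfun_def Bcontfun_inverse B_C_bcontfun primitive_in_B_C)

lemma alexiewicz_norm_eq: "f \<in> A_C \<Longrightarrow> alexiewicz_norm f = norm (primitive_bcontfun f)"
  by (simp add: alexiewicz_norm_def norm_bcontfun_def dist_bcontfun.rep_eq dist_real_def)

lemma primitive_bcontfun_add:
  "f \<in> A_C \<Longrightarrow> g \<in> A_C \<Longrightarrow> primitive_bcontfun (f + g) = primitive_bcontfun f + primitive_bcontfun g"
  by (rule bcontfun_eqI) (simp add: subspace_add[OF subspace_A_C] primitive_add)

lemma primitive_bcontfun_diff:
  "f \<in> A_C \<Longrightarrow> g \<in> A_C \<Longrightarrow> primitive_bcontfun (f - g) = primitive_bcontfun f - primitive_bcontfun g"
  by (rule bcontfun_eqI) (simp add: subspace_diff[OF subspace_A_C] primitive_diff)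

lemma primitive_bcontfun_scaleR:
  "f \<in> A_C \<Longrightarrow> primitive_bcontfun (a *\<^sub>R f) = a *\<^sub>R primitive_bcontfun f"
  by (rule bcontfun_eqI) (simp add: subspace_scale[OF subspace_A_C] primitive_scaleR)

lemma primitive_bcontfun_eq_0_iff:
  assumes "f \<in> A_C"
  shows "primitive_bcontfun f = 0 \<longleftrightarrow> f = 0"
proof
  assume "primitive_bcontfun f = 0"
  \<comment> \<open>Zero is written as \<open>0 * primitive f x\<close> to recognise it as the
    primitive of \<open>0 *\<^sub>R f\<close>.\<close>
  then have "primitive f = (\<lambda>x. 0 * primitive f x)"
    using assms by (metis apply_primitive_bcontfun mult_zero_left zero_bcontfun.rep_eq)
  also have "\<dots> = primitive (0 *\<^sub>R f)"
    using assms by (simp only: primitive_scaleR)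
  finally show "f = 0"
    using fun_deriv_primitive[OF assms] fun_deriv_primitive[OF subspace_0[OF subspace_A_C]] by simp
next
  assume "f = 0"
  then show "primitive_bcontfun f = 0"
    using primitive_bcontfun_scaleR[OF assms, of 0] by simp
qed

subsection \<open>The Banach lattice structure\<close>

text \<open>The library's completeness of bounded continuous functions requires a metric on the
  domain, and \<^typ>\<open>ereal\<close> is not an instance of \<^class>\<open>metric_space\<close>.\<close>

lemma Cauchy_bcontfun_obtains_limit:
  fixes f :: "nat \<Rightarrow> 'a::topological_space \<Rightarrow>\<^sub>C 'b::complete_space"
  assumes "Cauchy f"
  obtains l where "f \<longlonglongrightarrow> l"
proof -
  have "uniformly_Cauchy_on UNIV (\<lambda>n. apply_bcontfun (f n))"
  proof (rule uniformly_Cauchy_onI)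
    fix e :: real
    assume "e > 0"
    then obtain M where "\<And>m n. m \<ge> M \<Longrightarrow> n \<ge> M \<Longrightarrow> dist (f m) (f n) < e"
      using metric_CauchyD[OF assms] by blast
    then show "\<exists>M. \<forall>x\<in>UNIV. \<forall>m\<ge>M. \<forall>n\<ge>M. dist (f m x) (f n x) < e"
      by (blast intro: dist_fun_lt_imp_dist_val_lt)
  qed
  \<comment> \<open>The limit is first found pointwise and uniformly; being a uniform limit of
    bounded continuous functions, it lies in the same space.\<close>
  then obtain g where "uniform_limit UNIV (\<lambda>n. apply_bcontfun (f n)) g sequentially"
    using Cauchy_uniformly_convergent uniformly_convergent_on_def by blast
  then show thesis
    by (rule uniform_limit_bcontfunE) (use that in auto)
qed

text \<open>The image of \<open>A_C\<close> is closed among the bounded continuous functions: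
  evaluation at -infinity is continuous under uniform convergence, so the limit again vanishes there
  and is a primitive.\<close>

lemma alexiewicz_norm_complete:
  assumes X: "\<And>n. X n \<in> A_C"
    and Cauchy: "\<And>e. e > 0 \<Longrightarrow> \<exists>M. \<forall>m\<ge>M. \<forall>n\<ge>M. alexiewicz_norm (X m - X n) < e"
  shows "\<exists>f\<in>A_C. (\<lambda>n::nat. alexiewicz_norm (X n - f)) \<longlonglongrightarrow> 0"
proof -
  have norm_diff: "alexiewicz_norm (X n - g) = norm (primitive_bcontfun (X n) - primitive_bcontfun g)"
    if "g \<in> A_C" for n g
    using X that by (simp add: alexiewicz_norm_eq primitive_bcontfun_diff subspace_diff[OF subspace_A_C])
  have "Cauchy (\<lambda>n. primitive_bcontfun (X n))"
    using Cauchy unfolding Cauchy_def dist_norm by (simp add: norm_diff X)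
  then obtain L where L: "(\<lambda>n. primitive_bcontfun (X n)) \<longlonglongrightarrow> L"
    by (rule Cauchy_bcontfun_obtains_limit)
  have "(\<lambda>n. apply_bcontfun (primitive_bcontfun (X n)) (-\<infinity>)) \<longlonglongrightarrow> apply_bcontfun L (-\<infinity>)"
    by (rule tendsto_uniform_limitI[OF tendsto_bcontfun_uniform_limit[OF L]]) simp
  moreover have "apply_bcontfun (primitive_bcontfun (X n)) (-\<infinity>) = 0" for n
    using primitive_in_B_C[OF X, of n] X by (simp add: B_C_iff)
  ultimately have "apply_bcontfun L (-\<infinity>) = 0"
    by (simp add: LIMSEQ_const_iff)
  then have "apply_bcontfun L \<in> B_C"
    by (simp add: B_C_iff)
  then have f: "fun_deriv L \<in> A_C" "primitive_bcontfun (fun_deriv L) = L"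
    by (auto simp: primitive_bcontfun_def apply_bcontfun_inverse)
  have "(\<lambda>n. norm (primitive_bcontfun (X n) - L)) \<longlonglongrightarrow> 0"
    using L by (intro tendsto_norm_zero LIM_zero)
  then show ?thesis
    using f by (intro bexI[of _ "fun_deriv L"]) (simp_all add: norm_diff)
qed

lemma banach_space_A_C: "banach_space_on A_C alexiewicz_norm"
  unfolding banach_space_on_def
proof (intro conjI ballI allI impI)
  show "subspace A_C" by (rule subspace_A_C)
  show "0 \<le> alexiewicz_norm f" if "f \<in> A_C" for f
    using that by (simp add: alexiewicz_norm_eq)
  show "alexiewicz_norm f = 0 \<longleftrightarrow> f = 0" if "f \<in> A_C" for f
    using that by (simp add: alexiewicz_norm_eq primitive_bcontfun_eq_0_iff)
  show "alexiewicz_norm (a *\<^sub>R f) = \<bar>a\<bar> * alexiewicz_norm f" if "f \<in> A_C" for f a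
    using that by (simp add: alexiewicz_norm_eq primitive_bcontfun_scaleR subspace_scale[OF subspace_A_C])
  show "alexiewicz_norm (f + g) \<le> alexiewicz_norm f + alexiewicz_norm g"
    if "f \<in> A_C" "g \<in> A_C" for f g
    using that by (simp add: alexiewicz_norm_eq primitive_bcontfun_add subspace_add[OF subspace_A_C]
        norm_triangle_ineq)
  show "\<exists>f\<in>A_C. (\<lambda>n. alexiewicz_norm (X n - f)) \<longlonglongrightarrow> 0"
    if "(\<forall>n. X n \<in> A_C) \<and>
      (\<forall>e>0. \<exists>M. \<forall>m\<ge>M. \<forall>n\<ge>M. alexiewicz_norm (X m - X n) < e)" for X
    using that by (intro alexiewicz_norm_complete) simp_all
qed

section \<open>Order and lattice operations\<close>

lemma A_C_le_antisym:
  assumes "f \<in> A_C" "g \<in> A_C" "A_C_le f g" "A_C_le g f"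
  shows "f = g"
proof -
  have "primitive f = primitive g"
    using assms by (auto simp: A_C_le_def fun_eq_iff intro: antisym)
  then show ?thesis
    using assms(1,2) by (metis fun_deriv_primitive)
qed

lemma partial_order_A_C: "partial_order (order_on_set A_C A_C_le)"
proof
  have trans: "A_C_le f h" if "A_C_le f g" "A_C_le g h" for f g h
    using that unfolding A_C_le_def by (meson order_trans)
  let ?L = "order_on_set A_C A_C_le"
  show "f \<sqsubseteq>\<^bsub>?L\<^esub> h"
    if "f \<sqsubseteq>\<^bsub>?L\<^esub> g" "g \<sqsubseteq>\<^bsub>?L\<^esub> h" for f g h
    using that by (simp add: order_on_set_def) (rule trans)
qed (auto simp: order_on_set_def intro: A_C_le_antisym, auto simp: A_C_le_def)

lemma B_C_max: "F \<in> B_C \<Longrightarrow> G \<in> B_C \<Longrightarrow> (\<lambda>x. max (F x) (G x)) \<in> B_C"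
  by (auto simp: B_C_iff intro!: continuous_intros)

lemma B_C_min: "F \<in> B_C \<Longrightarrow> G \<in> B_C \<Longrightarrow> (\<lambda>x. min (F x) (G x)) \<in> B_C"
  by (auto simp: B_C_iff intro!: continuous_intros)

lemma B_C_abs: "F \<in> B_C \<Longrightarrow> (\<lambda>x. \<bar>F x\<bar>) \<in> B_C"
  by (auto simp: B_C_iff intro!: continuous_intros)

text \<open>\<open>B_C\<close> is closed under pointwise maxima, so suprema can be formed on the
  primitives.\<close>

lemma least_A_C:
  assumes "f \<in> A_C" "g \<in> A_C"
  shows "least (order_on_set A_C A_C_le) (fun_deriv (\<lambda>x. max (primitive f x) (primitive g x)))
    (Upper (order_on_set A_C A_C_le) {f, g})"
proof -
  have "(\<lambda>x. max (primitive f x) (primitive g x)) \<in> B_C"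
    using assms by (intro B_C_max primitive_in_B_C)
  then show ?thesis
    using assms by (auto simp: least_def Upper_def order_on_set_def A_C_le_def)
qed

lemma greatest_A_C:
  assumes "f \<in> A_C" "g \<in> A_C"
  shows "greatest (order_on_set A_C A_C_le) (fun_deriv (\<lambda>x. min (primitive f x) (primitive g x)))
    (Lower (order_on_set A_C A_C_le) {f, g})"
proof -
  have "(\<lambda>x. min (primitive f x) (primitive g x)) \<in> B_C"
    using assms by (intro B_C_min primitive_in_B_C)
  then show ?thesis
    using assms by (auto simp: greatest_def Lower_def order_on_set_def A_C_le_def)
qed

lemma lattice_A_C: "lattice (order_on_set A_C A_C_le)"
proof -
  interpret partial_order "order_on_set A_C A_C_le" by (rule partial_order_A_C)
  show ?thesis
    by standard (use least_A_C greatest_A_C in \<open>(force simp: order_on_set_def)+\<close>)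
qed

lemma lattice_abs_A_C:
  assumes "f \<in> A_C"
  shows "lattice_abs A_C A_C_le f = fun_deriv (\<lambda>x. \<bar>primitive f x\<bar>)"
proof -
  interpret lattice "order_on_set A_C A_C_le" by (rule lattice_A_C)
  have "- f \<in> A_C" using assms by (rule subspace_neg[OF subspace_A_C])
  \<comment> \<open>The join is some least upper bound picked by choice; uniqueness identifies it
    with the explicit one.\<close>
  then have "lattice_abs A_C A_C_le f = fun_deriv (\<lambda>x. max (primitive f x) (primitive (- f) x))"
    unfolding lattice_abs_def join_def
    using sup_of_two_least[of f "- f"] least_A_C[of f "- f"] assms
    by (intro least_unique) (auto simp: order_on_set_def)
  also have "(\<lambda>x. max (primitive f x) (primitive (- f) x)) = (\<lambda>x. \<bar>primitive f x\<bar>)"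
    by (simp add: primitive_uminus assms abs_real_def max_def fun_eq_iff)
  finally show ?thesis .
qed

text \<open>The hypothesis compares the absolute values of the primitives pointwise; passing to
  suprema preserves the inequality.\<close>

lemma alexiewicz_norm_mono:
  assumes "f \<in> A_C" "g \<in> A_C" "A_C_le (lattice_abs A_C A_C_le f) (lattice_abs A_C A_C_le g)"
  shows "alexiewicz_norm f \<le> alexiewicz_norm g"
proof -
  have "\<bar>primitive f x\<bar> \<le> \<bar>primitive g x\<bar>" for x
    using assms by (simp add: lattice_abs_A_C A_C_le_def B_C_abs primitive_in_B_C)
  also have "\<bar>primitive g x\<bar> \<le> norm (primitive_bcontfun g)" for x
    using norm_bounded[of "primitive_bcontfun g" x] assms by simp
  finally show ?thesis
    using assms by (auto simp: alexiewicz_norm_eq intro!: norm_bound)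
qed

theorem theorem23:
  shows "banach_lattice_on A_C A_C_le alexiewicz_norm \<and>
         (\<forall>f\<in>A_C. lattice_abs A_C A_C_le f = fun_deriv (\<lambda>x. \<bar>primitive f x\<bar>))"
  unfolding banach_lattice_on_def
proof (intro conjI ballI allI impI)
  show "A_C_le (f + h) (g + h)" if "f \<in> A_C" "g \<in> A_C" "h \<in> A_C" "A_C_le f g" for f g h
    using that by (simp add: A_C_le_def primitive_add)
  show "A_C_le (a *\<^sub>R f) (a *\<^sub>R g)" if "f \<in> A_C" "g \<in> A_C" "0 \<le> a" "A_C_le f g" for f g a
    using that by (simp add: A_C_le_def primitive_scaleR mult_left_mono)
qed (simp_all add: banach_space_A_C lattice_A_C alexiewicz_norm_mono lattice_abs_A_C)

end
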